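(* The rna number of a path $P_n$ with $n\ge 2$ vertices is $1$, and the rna number of a cycle $C_n$ ($n\ge 3$) is $2$. Moreover, for $G$ a path of order at least $2$ or a cycle, $\sigma^-(G)=\sigma^+(G)$ if and only if $G$ is $P_3$ or $C_4$.
   Context: For a graph $G$ with $N$ vertices and a bijection $f:V(G)\to\{1,\dots,N\}$, call an edge $uv$ negative under $f$ if $f(u)$ and $f(v)$ have opposite parity, and positive otherwise. The rna number $\sigma^-(G)$ is the minimum, over all such bijections $f$, of the number of negative edges under $f$; the adhika number $\sigma^+(G)$ is the maximum, over all such bijections, of the number of positive edges under $f$. *)

theory Defs
  imports Main
begin

record 'a ugraph =
  verts :: "'a set"
  edges :: "'a set set"

definition simple_graph :: "'a ugraph \<Rightarrow> bool" where
  "simple_graph G \<longleftrightarrow>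
     finite (verts G) \<and> (\<forall>e\<in>edges G. e \<subseteq> verts G \<and> card e = 2)"

definition graph_iso :: "'a ugraph \<Rightarrow> 'b ugraph \<Rightarrow> bool" (infix "\<cong>" 50) where
  "G \<cong> H \<longleftrightarrow>
     (\<exists>\<phi>. bij_betw \<phi> (verts G) (verts H) \<and>
        (\<forall>u\<in>verts G. \<forall>v\<in>verts G. {u, v} \<in> edges G \<longleftrightarrow> {\<phi> u, \<phi> v} \<in> edges H))"

definition path_graph :: "nat \<Rightarrow> nat ugraph" where
  "path_graph n = \<lparr>verts = {..<n}, edges = {{i, Suc i} | i. Suc i < n}\<rparr>"

text \<open>Only meaningful for \<open>n \<ge> 3\<close>: smaller values give a loop or a single edge.\<close>

definition cycle_graph :: "nat \<Rightarrow> nat ugraph" where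
  "cycle_graph n = \<lparr>verts = {..<n}, edges = {{i, Suc i mod n} | i. i < n}\<rparr>"

definition labelings :: "'a ugraph \<Rightarrow> ('a \<Rightarrow> nat) set" where
  "labelings G = {f. bij_betw f (verts G) {1..card (verts G)}}"

definition negative_edges :: "'a ugraph \<Rightarrow> ('a \<Rightarrow> nat) \<Rightarrow> 'a set set" where
  "negative_edges G f = {e \<in> edges G. \<exists>u v. e = {u, v} \<and> even (f u) \<noteq> even (f v)}"

definition positive_edges :: "'a ugraph \<Rightarrow> ('a \<Rightarrow> nat) \<Rightarrow> 'a set set" where
  "positive_edges G f = edges G - negative_edges G f"

definition rna_number :: "'a ugraph \<Rightarrow> nat" where
  "rna_number G = Min ((\<lambda>f. card (negative_edges G f)) ` labelings G)"

definition adhika_number :: "'a ugraph \<Rightarrow> nat" where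
  "adhika_number G = Max ((\<lambda>f. card (positive_edges G f)) ` labelings G)"

text \<open>The sets under \<^const>\<open>Min\<close> and \<^const>\<open>Max\<close> are finite and nonempty for every simple graph.\<close>

lemma simple_graph_finite_edges:
  assumes "simple_graph G"
  shows "finite (edges G)"
proof -
  have "edges G \<subseteq> Pow (verts G)" "finite (verts G)"
    using assms by (auto simp: simple_graph_def)
  then show ?thesis
    by (meson finite_Pow_iff finite_subset)
qed

lemma labelings_nonempty:
  assumes "simple_graph G"
  shows "labelings G \<noteq> {}"
proof -
  have "\<exists>f. bij_betw f (verts G) {1..card (verts G)}"
    using assms by (intro finite_same_card_bij) (auto simp: simple_graph_def)
  then show ?thesis
    by (auto simp: labelings_def)
qed

lemma finite_card_negative_edges:
  assumes "simple_graph G"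
  shows "finite ((\<lambda>f. card (negative_edges G f)) ` labelings G)"
  by (rule finite_subset[of _ "{..card (edges G)}"])
     (auto intro!: card_mono simple_graph_finite_edges assms simp: negative_edges_def)

lemma finite_card_positive_edges:
  assumes "simple_graph G"
  shows "finite ((\<lambda>f. card (positive_edges G f)) ` labelings G)"
  by (rule finite_subset[of _ "{..card (edges G)}"])
     (auto intro!: card_mono simple_graph_finite_edges assms simp: positive_edges_def)

lemma simple_graph_path_graph: "simple_graph (path_graph n)"
  by (auto simp: simple_graph_def path_graph_def)

lemma simple_graph_cycle_graph:
  assumes "n \<ge> 3"
  shows "simple_graph (cycle_graph n)"
proof -
  have "i \<noteq> Suc i mod n" if "i < n" for i
    using that assms by (cases "Suc i = n") auto
  then show ?thesis
    using assms by (auto simp: simple_graph_def cycle_graph_def card_insert_if)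
qed

end

theory Submission
  imports Defs
begin

text \<open>
  Positive and negative edges partition the edge set, so \<open>\<sigma>\<^sup>+(G) = |E(G)| - \<sigma>\<^sup>-(G)\<close>, and everything
  reduces to computing \<open>\<sigma>\<^sup>-\<close>. With at least two vertices both parities occur, so along a path the
  parity changes at least once, and around a cycle it changes on each of the two arcs between
  a vertex with an even label and one with an odd label. Placing all even labels before all odd
  labels shows that these bounds are attained. Hence \<open>\<sigma>\<^sup>- = \<sigma>\<^sup>+\<close> means \<open>1 = (n - 1) - 1\<close> for paths
  and \<open>2 = n - 2\<close> for cycles.
\<close>

lemma doubleton_in_negative_edges_iff:
  "{u, v} \<in> negative_edges G f \<longleftrightarrow> {u, v} \<in> edges G \<and> even (f u) \<noteq> even (f v)"
  by (auto simp: negative_edges_def doubleton_eq_iff)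

lemma simple_graph_edgeE:
  assumes "simple_graph G" "e \<in> edges G"
  obtains u v where "e = {u, v}" "u \<in> verts G" "v \<in> verts G"
proof -
  have "e \<subseteq> verts G" "card e = 2"
    using assms by (auto simp: simple_graph_def)
  then show ?thesis
    using that by (auto simp: card_2_iff)
qed

lemma finite_negative_edges: "simple_graph G \<Longrightarrow> finite (negative_edges G f)"
  by (simp add: negative_edges_def simple_graph_finite_edges)

lemma adhika_number_eq_card_edges_minus_rna_number:
  assumes "simple_graph G"
  shows "adhika_number G = card (edges G) - rna_number G"
proof -
  let ?N = "(\<lambda>f. card (negative_edges G f)) ` labelings G"
  have pos: "card (positive_edges G f) = card (edges G) - card (negative_edges G f)" for f
    unfolding positive_edges_def using finite_negative_edges[OF assms]
    by (intro card_Diff_subset) (auto simp: negative_edges_def)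
  have N: "finite ?N" "?N \<noteq> {}"
    using finite_card_negative_edges labelings_nonempty assms by auto
  obtain f where f: "f \<in> labelings G" "rna_number G = card (negative_edges G f)"
    using Min_in[OF N] unfolding rna_number_def by auto
  have least: "rna_number G \<le> card (negative_edges G g)" if "g \<in> labelings G" for g
    unfolding rna_number_def using N that by (intro Min_le) auto
  show ?thesis
    unfolding adhika_number_def
  proof (rule Max_eqI)
    show "finite ((\<lambda>f. card (positive_edges G f)) ` labelings G)"
      using finite_card_positive_edges assms .
    show "card (edges G) - rna_number G \<in> (\<lambda>f. card (positive_edges G f)) ` labelings G"
      using f by (auto simp: pos)
  qed (auto simp: pos intro!: diff_le_mono2 least)
qed

lemma rna_number_eqI:
  assumes "simple_graph G" "f \<in> labelings G" "card (negative_edges G f) \<le> k"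
    and "\<And>g. g \<in> labelings G \<Longrightarrow> k \<le> card (negative_edges G g)"
  shows "rna_number G = k"
  unfolding rna_number_def
  using assms finite_card_negative_edges[OF assms(1)]
  by (intro Min_eqI) (auto intro!: image_eqI[of _ _ f] antisym)

subsection \<open>Isomorphism invariance\<close>

lemma graph_iso_sym:
  assumes "G \<cong> H"
  shows "H \<cong> G"
proof -
  obtain \<phi> where \<phi>: "bij_betw \<phi> (verts G) (verts H)"
    "\<And>u v. \<lbrakk>u \<in> verts G; v \<in> verts G\<rbrakk> \<Longrightarrow> {u, v} \<in> edges G \<longleftrightarrow> {\<phi> u, \<phi> v} \<in> edges H"
    using assms by (auto simp: graph_iso_def)
  let ?\<psi> = "inv_into (verts G) \<phi>"
  have "bij_betw ?\<psi> (verts H) (verts G)"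
    using \<phi>(1) by (rule bij_betw_inv_into)
  moreover have "?\<psi> u \<in> verts G \<and> \<phi> (?\<psi> u) = u" if "u \<in> verts H" for u
    using that \<phi>(1) by (auto simp: bij_betw_def inv_into_into f_inv_into_f)
  ultimately show ?thesis
    unfolding graph_iso_def by (intro exI[of _ ?\<psi>]) (auto simp: \<phi>(2))
qed

lemma graph_iso_card_verts: "G \<cong> H \<Longrightarrow> card (verts G) = card (verts H)"
  by (auto simp: graph_iso_def bij_betw_same_card)

lemma graph_iso_edges:
  assumes "simple_graph G" "simple_graph H" "G \<cong> H"
  obtains \<phi> where "bij_betw \<phi> (verts G) (verts H)" "bij_betw ((`) \<phi>) (edges G) (edges H)"
proof -
  obtain \<phi> where \<phi>: "bij_betw \<phi> (verts G) (verts H)"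
    "\<And>u v. \<lbrakk>u \<in> verts G; v \<in> verts G\<rbrakk> \<Longrightarrow> {u, v} \<in> edges G \<longleftrightarrow> {\<phi> u, \<phi> v} \<in> edges H"
    using assms(3) by (auto simp: graph_iso_def)
  have "edges G \<subseteq> Pow (verts G)"
    using assms(1) by (auto simp: simple_graph_def)
  then have inj: "inj_on ((`) \<phi>) (edges G)"
    using \<phi>(1) by (meson bij_betw_def inj_on_image_Pow inj_on_subset)
  have "(`) \<phi> ` edges G = edges H"
  proof (intro equalityI subsetI)
    fix e assume "e \<in> (`) \<phi> ` edges G"
    then obtain d where d: "d \<in> edges G" "e = \<phi> ` d"
      by auto
    then obtain u v where "d = {u, v}" "u \<in> verts G" "v \<in> verts G"
      using assms(1) simple_graph_edgeE by blast
    then show "e \<in> edges H"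
      using d \<phi>(2) by auto
  next
    fix e assume e: "e \<in> edges H"
    then obtain u v where "e = {u, v}" "u \<in> \<phi> ` verts G" "v \<in> \<phi> ` verts G"
      using assms(2) \<phi>(1) by (metis bij_betw_def simple_graph_edgeE)
    then obtain x y where "e = \<phi> ` {x, y}" "x \<in> verts G" "y \<in> verts G"
      by auto
    then show "e \<in> (`) \<phi> ` edges G"
      using e \<phi>(2)[of x y] by (intro image_eqI[of _ _ "{x, y}"]) auto
  qed
  with inj \<phi>(1) that show ?thesis
    by (simp add: bij_betw_def)
qed

lemma graph_iso_card_edges:
  assumes "simple_graph G" "simple_graph H" "G \<cong> H"
  shows "card (edges G) = card (edges H)"
  using graph_iso_edges[OF assms] by (metis bij_betw_same_card)

lemma graph_iso_negative_edges_subset: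
  assumes "simple_graph G" "simple_graph H" "G \<cong> H"
  shows "(\<lambda>f. card (negative_edges H f)) ` labelings H
         \<subseteq> (\<lambda>f. card (negative_edges G f)) ` labelings G"
proof
  fix k assume "k \<in> (\<lambda>f. card (negative_edges H f)) ` labelings H"
  then obtain f where f: "f \<in> labelings H" and k: "k = card (negative_edges H f)"
    by auto
  obtain \<phi> where \<phi>: "bij_betw \<phi> (verts G) (verts H)" "bij_betw ((`) \<phi>) (edges G) (edges H)"
    using graph_iso_edges[OF assms] .
  have "f \<circ> \<phi> \<in> labelings G"
    using f \<phi>(1) graph_iso_card_verts[OF assms(3)]
    by (auto simp: labelings_def intro: bij_betw_trans)
  moreover have neg: "\<phi> ` e \<in> negative_edges H f \<longleftrightarrow> e \<in> negative_edges G (f \<circ> \<phi>)"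
    if e: "e \<in> edges G" for e
  proof -
    obtain u v where "e = {u, v}"
      using assms(1) e by (rule simple_graph_edgeE)
    moreover have "\<phi> ` e \<in> edges H"
      using e \<phi>(2) by (auto simp: bij_betw_def)
    ultimately show ?thesis
      using e by (simp add: doubleton_in_negative_edges_iff)
  qed
  have "bij_betw ((`) \<phi>) (negative_edges G (f \<circ> \<phi>)) (negative_edges H f)"
    unfolding bij_betw_def
  proof
    show "inj_on ((`) \<phi>) (negative_edges G (f \<circ> \<phi>))"
      using \<phi>(2) by (rule inj_on_subset[OF bij_betw_imp_inj_on]) (auto simp: negative_edges_def)
    have "negative_edges H f \<subseteq> (`) \<phi> ` edges G"
      using \<phi>(2) by (auto simp: bij_betw_def negative_edges_def)
    moreover have "negative_edges G (f \<circ> \<phi>) \<subseteq> edges G"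
      by (auto simp: negative_edges_def)
    ultimately show "(`) \<phi> ` negative_edges G (f \<circ> \<phi>) = negative_edges H f"
      using neg by blast
  qed
  then have "k = card (negative_edges G (f \<circ> \<phi>))"
    unfolding k by (metis bij_betw_same_card)
  ultimately show "k \<in> (\<lambda>f. card (negative_edges G f)) ` labelings G"
    by auto
qed

lemma graph_iso_rna_number:
  assumes "simple_graph G" "simple_graph H" "G \<cong> H"
  shows "rna_number G = rna_number H"
  using graph_iso_negative_edges_subset[OF assms]
    graph_iso_negative_edges_subset[OF assms(2,1) graph_iso_sym[OF assms(3)]]
  by (simp add: rna_number_def subset_antisym)

subsection \<open>Paths and cycles\<close>

lemma even_labels_first_labeling:
  fixes n :: nat
  obtains f :: "nat \<Rightarrow> nat" where "bij_betw f {..<n} {1..n}" "\<And>i. even (f i) \<longleftrightarrow> i < n div 2"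
proof
  let ?f = "\<lambda>i. if i < n div 2 then 2 * i + 2 else 2 * (i - n div 2) + 1"
  have "inj_on ?f {..<n}"
  proof (rule inj_onI)
    fix i j assume eq: "?f i = ?f j"
    then have "i < n div 2 \<longleftrightarrow> j < n div 2"
      by (auto split: if_splits dest: arg_cong[of _ _ even])
    with eq show "i = j"
      by (auto split: if_splits)
  qed
  moreover have "?f ` {..<n} \<subseteq> {1..n}"
    by auto
  ultimately show "bij_betw ?f {..<n} {1..n}"
    unfolding bij_betw_def using card_subset_eq[of "{1..n}" "?f ` {..<n}"]
    by (simp only: card_image finite_atLeastAtMost card_lessThan card_atLeastAtMost)
qed auto

lemma exists_change_index:
  fixes P :: "nat \<Rightarrow> bool"
  assumes "a \<le> b" "P a \<noteq> P b"
  obtains i where "a \<le> i" "i < b" "P i \<noteq> P (Suc i)"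
proof -
  have "\<exists>i. a \<le> i \<and> i < b \<and> P i \<noteq> P (Suc i)"
    using assms
  proof (induction b rule: dec_induct)
    case (step b)
    then show ?case
      by (cases "P b = P (Suc b)") (auto intro: less_SucI)
  qed simp
  then show ?thesis
    using that by blast
qed

lemma exists_opposite_parity_labels:
  fixes f :: "nat \<Rightarrow> nat"
  assumes "bij_betw f {..<n} {1..n}" "n \<ge> 2"
  obtains a b where "a < b" "b < n" "even (f a) \<noteq> even (f b)"
proof -
  have "1 \<in> f ` {..<n}" "2 \<in> f ` {..<n}"
    using assms by (auto simp: bij_betw_def)
  then obtain x y where "x < n" "y < n" "f x = 1" "f y = 2"
    by (metis imageE lessThan_iff)
  then show ?thesis
    using that[of x y] that[of y x] by (cases x y rule: linorder_cases) auto
qed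

lemma card_edges_path_graph: "card (edges (path_graph n)) = n - 1"
proof -
  have "edges (path_graph n) = (\<lambda>i. {i, Suc i}) ` {..<n - 1}"
    by (auto simp: path_graph_def)
  moreover have "inj_on (\<lambda>i. {i, Suc i}) {..<n - 1}"
    by (auto simp: inj_on_def doubleton_eq_iff)
  ultimately show ?thesis
    by (simp add: card_image)
qed

lemma rna_number_path_graph:
  assumes "n \<ge> 2"
  shows "rna_number (path_graph n) = 1"
proof -
  obtain f where f: "bij_betw f {..<n} {1..n}" "\<And>i. even (f i) \<longleftrightarrow> i < n div 2"
    using even_labels_first_labeling by blast
  show ?thesis
  proof (rule rna_number_eqI[OF simple_graph_path_graph])
    show "f \<in> labelings (path_graph n)"
      using f by (simp add: labelings_def path_graph_def)
    have "negative_edges (path_graph n) f \<subseteq> {{n div 2 - 1, n div 2}}"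
    proof
      fix e assume e: "e \<in> negative_edges (path_graph n) f"
      then obtain i where i: "e = {i, Suc i}"
        by (auto simp: negative_edges_def path_graph_def)
      with e have "i < n div 2 \<longleftrightarrow> \<not> Suc i < n div 2"
        by (auto simp: doubleton_in_negative_edges_iff f(2))
      then have "Suc i = n div 2"
        by linarith
      then show "e \<in> {{n div 2 - 1, n div 2}}"
        using i by (metis diff_Suc_1 singletonI)
    qed
    then show "card (negative_edges (path_graph n) f) \<le> 1"
      using card_mono[of "{{n div 2 - 1, n div 2}}"] by force
  next
    fix g assume "g \<in> labelings (path_graph n)"
    then have "bij_betw g {..<n} {1..n}"
      by (simp add: labelings_def path_graph_def)
    then obtain a b where ab: "a < b" "b < n" "even (g a) \<noteq> even (g b)"
      using assms exists_opposite_parity_labels by blast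
    then obtain i where i: "a \<le> i" "i < b" "even (g i) \<noteq> even (g (Suc i))"
      using exists_change_index[of a b "\<lambda>i. even (g i)"] by auto
    then have "{i, Suc i} \<in> negative_edges (path_graph n) g"
      using ab by (auto simp: doubleton_in_negative_edges_iff path_graph_def)
    then show "1 \<le> card (negative_edges (path_graph n) g)"
      using finite_negative_edges[OF simple_graph_path_graph]
      by (metis One_nat_def Suc_leI card_gt_0_iff empty_iff)
  qed
qed

text \<open>For \<open>n = 2\<close> this fails: the two indices give the same doubleton.\<close>

lemma inj_on_cycle_edge:
  assumes "n \<ge> 3"
  shows "inj_on (\<lambda>i. {i, Suc i mod n}) {..<n}"
proof (rule inj_onI)
  fix i j assume ij: "i \<in> {..<n}" "j \<in> {..<n}" "{i, Suc i mod n} = {j, Suc j mod n}"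
  show "i = j"
    using ij assms
    by (cases "Suc i = n"; cases "Suc j = n") (auto simp: doubleton_eq_iff)
qed

lemma card_edges_cycle_graph:
  assumes "n \<ge> 3"
  shows "card (edges (cycle_graph n)) = n"
proof -
  have "edges (cycle_graph n) = (\<lambda>i. {i, Suc i mod n}) ` {..<n}"
    by (auto simp: cycle_graph_def)
  then show ?thesis
    by (simp add: card_image inj_on_cycle_edge[OF assms])
qed

lemma rna_number_cycle_graph:
  assumes "n \<ge> 3"
  shows "rna_number (cycle_graph n) = 2"
proof -
  obtain f where f: "bij_betw f {..<n} {1..n}" "\<And>i. even (f i) \<longleftrightarrow> i < n div 2"
    using even_labels_first_labeling by blast
  show ?thesis
  proof (rule rna_number_eqI[OF simple_graph_cycle_graph[OF assms]])
    show "f \<in> labelings (cycle_graph n)"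
      using f by (simp add: labelings_def cycle_graph_def)
    let ?S = "{{n div 2 - 1, n div 2}, {n - 1, 0}}"
    have "negative_edges (cycle_graph n) f \<subseteq> ?S"
    proof
      fix e assume e: "e \<in> negative_edges (cycle_graph n) f"
      then obtain i where i: "i < n" "e = {i, Suc i mod n}"
        by (auto simp: negative_edges_def cycle_graph_def)
      show "e \<in> ?S"
      proof (cases "Suc i = n")
        case True
        then show ?thesis
          using i by auto
      next
        case False
        then have i': "e = {i, Suc i}"
          using i by simp
        with e have "i < n div 2 \<longleftrightarrow> \<not> Suc i < n div 2"
          by (auto simp: doubleton_in_negative_edges_iff f(2))
        then have "Suc i = n div 2"
          by linarith
        then show ?thesis
          using i' by (metis diff_Suc_1 insertI1)
      qed
    qed
    then have "card (negative_edges (cycle_graph n) f) \<le> card ?S"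
      by (intro card_mono) auto
    also have "\<dots> \<le> 2"
      by (simp add: card_insert_if)
    finally show "card (negative_edges (cycle_graph n) f) \<le> 2" .
  next
    fix g assume "g \<in> labelings (cycle_graph n)"
    then have "bij_betw g {..<n} {1..n}" "2 \<le> n"
      using assms by (simp_all add: labelings_def cycle_graph_def)
    then obtain a b where ab: "a < b" "b < n" "even (g a) \<noteq> even (g b)"
      using exists_opposite_parity_labels by blast
    let ?e = "\<lambda>i. {i, Suc i mod n}"
    obtain i where i: "a \<le> i" "i < b" "even (g i) \<noteq> even (g (Suc i))"
      using exists_change_index[of a b "\<lambda>i. even (g i)"] ab by (metis less_imp_le)
    obtain j where j: "b \<le> j" "j < a + n" "even (g (j mod n)) \<noteq> even (g (Suc j mod n))"
    proof (rule exists_change_index[of b "a + n" "\<lambda>i. even (g (i mod n))"])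
      show "even (g (b mod n)) \<noteq> even (g ((a + n) mod n))"
        using ab by simp
    qed (use ab in auto)
    have edge: "?e k \<in> edges (cycle_graph n)" if "k < n" for k
      using that by (auto simp: cycle_graph_def)
    have "?e i \<in> negative_edges (cycle_graph n) g"
      using i ab edge[of i] by (simp add: doubleton_in_negative_edges_iff)
    moreover have "?e (j mod n) \<in> negative_edges (cycle_graph n) g"
      unfolding doubleton_in_negative_edges_iff mod_Suc_eq
      using j ab edge[of "j mod n"] by (simp add: mod_Suc_eq)
    ultimately have "{?e i, ?e (j mod n)} \<subseteq> negative_edges (cycle_graph n) g"
      by simp
    moreover have "i \<noteq> j mod n"
    proof (cases "j < n")
      case False
      then have "j mod n = j - n"
        using j ab by (simp add: mod_if)
      then show ?thesis
        using i j False by linarith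
    qed (use i j in auto)
    then have "?e i \<noteq> ?e (j mod n)"
      using inj_onD[OF inj_on_cycle_edge[OF assms], of i "j mod n"] i ab by auto
    ultimately show "2 \<le> card (negative_edges (cycle_graph n) g)"
      using card_mono[OF finite_negative_edges[OF simple_graph_cycle_graph[OF assms]]]
      by (metis card_2_iff)
  qed
qed

lemma graph_iso_path_graph_numbers:
  assumes "simple_graph G" "G \<cong> path_graph n" "n \<ge> 2"
  shows "rna_number G = 1" "adhika_number G = n - 2" "card (verts G) = n"
proof -
  show rna: "rna_number G = 1"
    using graph_iso_rna_number[OF assms(1) simple_graph_path_graph assms(2)]
      rna_number_path_graph[OF assms(3)] by simp
  show "adhika_number G = n - 2"
    using graph_iso_card_edges[OF assms(1) simple_graph_path_graph assms(2)] rna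
    by (simp add: adhika_number_eq_card_edges_minus_rna_number assms card_edges_path_graph)
  show "card (verts G) = n"
    using graph_iso_card_verts[OF assms(2)] by (simp add: path_graph_def)
qed

lemma graph_iso_cycle_graph_numbers:
  assumes "simple_graph G" "G \<cong> cycle_graph n" "n \<ge> 3"
  shows "rna_number G = 2" "adhika_number G = n - 2" "card (verts G) = n"
proof -
  note simple = simple_graph_cycle_graph[OF assms(3)]
  show rna: "rna_number G = 2"
    using graph_iso_rna_number[OF assms(1) simple assms(2)]
      rna_number_cycle_graph[OF assms(3)] by simp
  show "adhika_number G = n - 2"
    using graph_iso_card_edges[OF assms(1) simple assms(2)] rna
    by (simp add: adhika_number_eq_card_edges_minus_rna_number assms card_edges_cycle_graph)
  show "card (verts G) = n"
    using graph_iso_card_verts[OF assms(2)] by (simp add: cycle_graph_def)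
qed

theorem theorem11:
  fixes G :: "'a ugraph"
  assumes "simple_graph G"
  shows "(\<forall>n\<ge>2. G \<cong> path_graph n \<longrightarrow> rna_number G = 1) \<and>
         (\<forall>n\<ge>3. G \<cong> cycle_graph n \<longrightarrow> rna_number G = 2) \<and>
         ((\<exists>n\<ge>2. G \<cong> path_graph n) \<or> (\<exists>n\<ge>3. G \<cong> cycle_graph n) \<longrightarrow>
           (rna_number G = adhika_number G \<longleftrightarrow> G \<cong> path_graph 3 \<or> G \<cong> cycle_graph 4))"
proof (intro conjI allI impI)
  assume "(\<exists>n\<ge>2. G \<cong> path_graph n) \<or> (\<exists>n\<ge>3. G \<cong> cycle_graph n)"
  then show "rna_number G = adhika_number G \<longleftrightarrow> G \<cong> path_graph 3 \<or> G \<cong> cycle_graph 4"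
  proof (elim disjE exE conjE)
    fix n assume n: "2 \<le> n" "G \<cong> path_graph n"
    note G = graph_iso_path_graph_numbers[OF assms n(2,1)]
    show ?thesis
    proof
      assume "rna_number G = adhika_number G"
      then have "n = 3"
        using G n by simp
      then show "G \<cong> path_graph 3 \<or> G \<cong> cycle_graph 4"
        using n by simp
    next
      assume "G \<cong> path_graph 3 \<or> G \<cong> cycle_graph 4"
      then show "rna_number G = adhika_number G"
        using G graph_iso_path_graph_numbers[OF assms, of 3]
          graph_iso_cycle_graph_numbers[OF assms, of 4] by auto
    qed
  next
    fix n assume n: "3 \<le> n" "G \<cong> cycle_graph n"
    note G = graph_iso_cycle_graph_numbers[OF assms n(2,1)]
    show ?thesis
    proof
      assume "rna_number G = adhika_number G"
      then have "n = 4"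
        using G n by simp
      then show "G \<cong> path_graph 3 \<or> G \<cong> cycle_graph 4"
        using n by simp
    next
      assume "G \<cong> path_graph 3 \<or> G \<cong> cycle_graph 4"
      then show "rna_number G = adhika_number G"
        using G graph_iso_path_graph_numbers[OF assms, of 3]
          graph_iso_cycle_graph_numbers[OF assms, of 4] by auto
    qed
  qed
qed (use assms graph_iso_path_graph_numbers graph_iso_cycle_graph_numbers in blast)+

end
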